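(* Let $X=\mathbb{R}^n$ or a compact subset of $\mathbb{R}^n$, let $Y=\mathbb{R}$ (both with Borel $\sigma$-algebras), and let $P\sim\mathcal{GP}(m,k)$ be a Gaussian process on $Y^X$. Let $\mathbf{x}\in X$ with $k(\mathbf{x},\mathbf{x})>0$, and let $\mathcal{S}^{\mathbf{x}}=\delta_{ev_{\mathbf{x}}}\colon Y^X\to Y$ be the noise free sampling distribution, $\mathcal{S}^{\mathbf{x}}(B\mid f)=1$ if $f(\mathbf{x})\in B$ and $0$ otherwise. Suppose $\mathcal{I}^{\mathbf{x}}\colon Y\to Y^X$ is a Markov kernel such that for every $y\in Y$ the probability measure $\mathcal{I}^{\mathbf{x}}(\cdot\mid y)$ is a Gaussian process $\mathcal{GP}(m^1,k^1)$ on $Y^X$ with $$m^1(\mathbf{z})=m(\mathbf{z})+\frac{k(\mathbf{z},\mathbf{x})}{k(\mathbf{x},\mathbf{x})}\,(y-m(\mathbf{x})),\qquad k^1(\mathbf{w},\mathbf{z})=k(\mathbf{w},\mathbf{z})-\frac{k(\mathbf{w},\mathbf{x})\,k(\mathbf{x},\mathbf{z})}{k(\mathbf{x},\mathbf{x})}$$ for all $\mathbf{w},\mathbf{z}\in X$. Then $\mathcal{I}^{\mathbf{x}}$ is an inference map for the prior $P$ and the sampling distribution $\mathcal{S}^{\mathbf{x}}$; that is, for all $\mathcal{A}\in\Sigma_{Y^X}$ and all $B\in\Sigma_Y$, $$\int_{\mathcal{A}}\mathcal{S}^{\mathbf{x}}(B\mid f)\,dP(f)=\int_{B}\mathcal{I}^{\mathbf{x}}(\mathcal{A}\mid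 y)\,d(P\,ev_{\mathbf{x}}^{-1})(y).$$
   Context: $Y^X$ denotes the set of all measurable functions $X\to Y$, with the $\sigma$-algebra $\Sigma_{Y^X}$ generated by the point evaluation maps $ev_{\mathbf{z}}\colon Y^X\to Y$, $f\mapsto f(\mathbf{z})$, $\mathbf{z}\in X$. $P\,ev_{\mathbf{x}}^{-1}$ denotes the push forward of $P$ along $ev_{\mathbf{x}}$. A Markov kernel $T\colon Z\to W$ assigns to each $z\in Z$ a probability measure $T(\cdot\mid z)$ on $W$ such that $T(B\mid\cdot)$ is measurable on $Z$ for each measurable $B\subset W$ (in the paper's category the probability measures are in addition required to be perfect: a probability measure $Q$ on $W$ is perfect if for every measurable $g\colon W\to\mathbb{R}$ there is a Borel set $E\subset g(W)$ with $Q(g^{-1}(E))=1$). A Gaussian process $P\sim\mathcal{GP}(m,k)$ on $Y^X$, with $m\in Y^X$ and $k\colon X\times X\to\mathbb{R}$, is a probability measure $P$ on $Y^X$ such that for every finite subset $X_0\subset X$ the push forward of $P$ along the restriction map $Y^X\to Y^{X_0}$, $f\mapsto f|_{X_0}$, is the (possibly degenerate) multivariate Gaussian distribution with mean $m|_{X_0}$ and covariance matrix $k|_{X_0\times X_0}$. For the prior covariance function $k$ the paper assumes, for all $\mathbf{x},\mathbf{z}\in X$: $k(\mathbf{x},\mathbf{z})\ge 0$, $k(\mathbf{x},\mathbf{z})=k(\mathbf{z},\mathbf{x})$, and $k(\mathbf{x},\mathbf{x})k(\mathbf{z},\mathbf{z})-k(\mathbf{x},\mathbf{z})^2\ge 0$.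 *)

theory Defs
  imports "HOL-Probability.Probability"
begin

text \<open>
  The space \<open>Y\<^sup>X\<close> of measurable functions with the \<open>\<sigma>\<close>-algebra generated by the point
  evaluations. A function on the carrier \<open>space X\<close> is represented by its
  \<^const>\<open>extensional\<close> extension, so that distinct elements differ somewhere on \<open>space X\<close>.
\<close>

definition fun_carrier :: "'a measure \<Rightarrow> 'b measure \<Rightarrow> ('a \<Rightarrow> 'b) set" where
  "fun_carrier X Y = {f \<in> measurable X Y. f \<in> extensional (space X)}"

definition fun_space :: "'a measure \<Rightarrow> 'b measure \<Rightarrow> ('a \<Rightarrow> 'b) measure" where
  "fun_space X Y =
    sigma (fun_carrier X Y) {{f \<in> fun_carrier X Y. f z \<in> B} | z B. z \<in> space X \<and> B \<in> sets Y}"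

definition perfect_measure :: "'a measure \<Rightarrow> bool" where
  "perfect_measure Q \<longleftrightarrow>
    (\<forall>g :: 'a \<Rightarrow> real. g \<in> borel_measurable Q \<longrightarrow>
      (\<exists>E \<in> sets borel. E \<subseteq> g ` space Q \<and> emeasure Q (g -` E \<inter> space Q) = 1))"

text \<open>
  Measurability into \<^const>\<open>prob_algebra\<close> says that every \<open>T z\<close> is a probability measure on \<open>W\<close>
  and that \<open>z \<mapsto> T z B\<close> is measurable for every measurable \<open>B\<close>.
\<close>

definition markov_kernel :: "'a measure \<Rightarrow> 'b measure \<Rightarrow> ('a \<Rightarrow> 'b measure) \<Rightarrow> bool" where
  "markov_kernel Z W T \<longleftrightarrow>
    T \<in> measurable Z (prob_algebra W) \<and> (\<forall>z \<in> space Z. perfect_measure (T z))"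

text \<open>
  The univariate normal distribution with standard deviation \<open>\<sigma> \<ge> 0\<close>; for \<open>\<sigma> = 0\<close> it is the
  point mass.
\<close>

definition normal_distribution :: "real \<Rightarrow> real \<Rightarrow> real measure" where
  "normal_distribution \<mu> \<sigma> =
    (if \<sigma> = 0 then return borel \<mu> else density lborel (normal_density \<mu> \<sigma>))"

text \<open>
  \<open>Q\<close> is the possibly degenerate Gaussian distribution on \<open>\<real>\<^sup>I\<close>, for finite \<open>I\<close>, with mean vector
  \<open>m\<close> and covariance matrix \<open>K\<close>: every linear combination of the coordinates is normally
  distributed, and the first and second central moments are \<open>m\<close> and \<open>K\<close>. The coordinates are
  then square integrable, so the moment integrals are genuine.
\<close>

definition multivariate_gaussian ::
    "'a set \<Rightarrow> ('a \<Rightarrow> real) measure \<Rightarrow> ('a \<Rightarrow> real) \<Rightarrow> ('a \<Rightarrow> 'a \<Rightarrow> real) \<Rightarrow> bool" where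
  "multivariate_gaussian I Q m K \<longleftrightarrow>
    prob_space Q \<and> sets Q = sets (PiM I (\<lambda>_. borel)) \<and>
    (\<forall>a :: 'a \<Rightarrow> real. \<exists>\<mu> \<sigma>. 0 \<le> \<sigma> \<and>
      distr Q borel (\<lambda>f. \<Sum>i\<in>I. a i * f i) = normal_distribution \<mu> \<sigma>) \<and>
    (\<forall>i\<in>I. (\<integral>f. f i \<partial>Q) = m i) \<and>
    (\<forall>i\<in>I. \<forall>j\<in>I. (\<integral>f. (f i - m i) * (f j - m j) \<partial>Q) = K i j)"

definition gaussian_process ::
    "'a measure \<Rightarrow> ('a \<Rightarrow> real) measure \<Rightarrow> ('a \<Rightarrow> real) \<Rightarrow> ('a \<Rightarrow> 'a \<Rightarrow> real) \<Rightarrow> bool" where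
  "gaussian_process X P m k \<longleftrightarrow>
    m \<in> borel_measurable X \<and>
    prob_space P \<and> sets P = sets (fun_space X borel) \<and>
    (\<forall>X0. finite X0 \<and> X0 \<subseteq> space X \<longrightarrow>
      multivariate_gaussian X0 (distr P (PiM X0 (\<lambda>_. borel)) (\<lambda>f. restrict f X0)) m k)"

definition noise_free_sampling :: "'a \<Rightarrow> ('a \<Rightarrow> real) \<Rightarrow> real measure" where
  "noise_free_sampling x f = return borel (f x)"

end

theory Submission
  imports Defs
begin

text \<open>
  Two observations carry the proof. Write \<open>\<nu>\<close> for the law of \<open>f x\<close> under \<open>P\<close>.

  First, \<open>\<I> y\<close> gives \<open>f x\<close> mean \<open>y\<close> and variance \<open>k x x - k x x * k x x / k x x = 0\<close>, so it is
  concentrated on the functions with \<open>f x = y\<close> (\<open>gaussian_process_conditional_AE_eq\<close>). Hence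
  \<open>\<I> y (A \<inter> {f. f x \<in> B})\<close> is \<open>\<I> y A\<close> if \<open>y \<in> B\<close> and \<open>0\<close> otherwise, and the identity to be proved
  says that \<open>P\<close> and the mixture \<open>\<nu> \<bind> \<I>\<close> agree on \<open>A \<inter> {f. f x \<in> B}\<close>.

  Second, \<open>\<nu> \<bind> \<I> = P\<close> (\<open>gaussian_process_bind_conditional\<close>). It suffices to compare the
  characteristic functions of all finite linear combinations \<open>\<Sum>i\<in>K. a i * f i\<close>. If such a
  combination has mean \<open>\<mu>\<close> and variance \<open>v\<close> under \<open>P\<close>, then under \<open>\<I> y\<close> it has mean
  \<open>\<mu> + c * (y - m x)\<close> and variance \<open>v - c\<^sup>2 * k x x\<close>, where \<open>c\<close> is its regression coefficient on
  \<open>f x\<close>; integrating over the normal law \<open>\<nu>\<close> of variance \<open>k x x\<close> restores exactly the missing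
  \<open>c\<^sup>2 * k x x\<close>.

  That these characteristic functions determine the measure is the Cramer-Wold device
  (\<open>measure_Inter_vimage_eqI\<close>, \<open>fun_space_measure_eqI\<close>). It is obtained from the one-dimensional
  uniqueness theorem of Levy by exchanging one exponential factor at a time for the indicator of a
  Borel set.
\<close>

section \<open>The Cramer-Wold device\<close>

text \<open>
  A nonnegative weight \<open>W\<close> turns \<open>M\<close> and \<open>N\<close> into finite measures, and the hypothesis compares
  the characteristic functions of \<open>\<psi>\<close> under them. The value at \<open>t = 0\<close> shows that both have the same
  mass \<open>c\<close>; unless \<open>c = 0\<close>, both can be normalised by it, which reduces the claim to Levy's theorem.
\<close>

lemma integral_weight_indicator_eqI:
  fixes W \<psi> :: "'a \<Rightarrow> real"
  assumes M: "finite_measure M" and N: "finite_measure N" and sets: "sets N = sets M"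
    and W[measurable]: "W \<in> borel_measurable M"
    and \<psi>[measurable]: "\<psi> \<in> borel_measurable M"
    and W_bounds: "\<And>f. 0 \<le> W f" "\<And>f. W f \<le> C"
    and eq: "\<And>t. (\<integral>f. W f *\<^sub>R iexp (t * \<psi> f) \<partial>M) = (\<integral>f. W f *\<^sub>R iexp (t * \<psi> f) \<partial>N)"
    and B[measurable]: "B \<in> sets borel"
  shows "(\<integral>f. W f * indicator B (\<psi> f) \<partial>M) = (\<integral>f. W f * indicator B (\<psi> f) \<partial>N)"
proof -
  interpret M: finite_measure M by fact
  interpret N: finite_measure N by fact
  note [measurable_cong] = sets
  have intM: "integrable M W" and intN: "integrable N W"
    using W_bounds by (auto intro!: M.integrable_const_bound[where B=C] N.integrable_const_bound[where B=C])
  define c where "c = (\<integral>f. W f \<partial>M)"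
  have "complex_of_real c = complex_of_real (\<integral>f. W f \<partial>N)"
    using eq[of 0] by (simp add: c_def scaleR_conv_of_real)
  then have c_N: "c = (\<integral>f. W f \<partial>N)"
    using of_real_eq_iff by blast
  have c_nonneg: "0 \<le> c"
    unfolding c_def using W_bounds by simp
  \<comment> \<open>The integrals of complex functions give the characteristic function, those of real functions the
    conclusion.\<close>
  have dens: "real_distribution (distr (density L (\<lambda>f. W f / c)) borel \<psi>)
      \<and> (\<forall>g::real \<Rightarrow> complex. g \<in> borel_measurable borel \<longrightarrow> (\<integral>x. g x \<partial>distr (density L (\<lambda>f. W f / c)) borel \<psi>) = (\<integral>f. W f *\<^sub>R g (\<psi> f) \<partial>L) / c)
      \<and> (\<forall>g::real \<Rightarrow> real. g \<in> borel_measurable borel \<longrightarrow> (\<integral>x. g x \<partial>distr (density L (\<lambda>f. W f / c)) borel \<psi>) = (\<integral>f. W f *\<^sub>R g (\<psi> f) \<partial>L) / c)"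
    if c: "c > 0" and sL[measurable_cong]: "sets L = sets M" and L: "integrable L W" "c = (\<integral>f. W f \<partial>L)" for L
  proof (intro conjI allI impI)
    have "(\<integral>\<^sup>+ f. ennreal (W f / c) \<partial>L) = ennreal (\<integral>f. W f / c \<partial>L)"
      using L W_bounds c by (intro nn_integral_eq_integral) auto
    also have "\<dots> = 1"
      using L c by simp
    finally have "prob_space (density L (\<lambda>f. W f / c))"
      by (intro prob_spaceI) (simp add: emeasure_density cong: nn_integral_cong)
    then show "real_distribution (distr (density L (\<lambda>f. W f / c)) borel \<psi>)"
      unfolding real_distribution_def real_distribution_axioms_def
      by (auto intro!: prob_space.prob_space_distr)
  next
    fix g :: "real \<Rightarrow> complex" assume [measurable]: "g \<in> borel_measurable borel"
    show "(\<integral>x. g x \<partial>distr (density L (\<lambda>f. W f / c)) borel \<psi>) = (\<integral>f. W f *\<^sub>R g (\<psi> f) \<partial>L) / c"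
      using W_bounds c
      by (simp add: integral_distr integral_density scaleR_conv_of_real flip: integral_divide_zero)
  next
    fix g :: "real \<Rightarrow> real" assume [measurable]: "g \<in> borel_measurable borel"
    show "(\<integral>x. g x \<partial>distr (density L (\<lambda>f. W f / c)) borel \<psi>) = (\<integral>f. W f *\<^sub>R g (\<psi> f) \<partial>L) / c"
      using W_bounds c
      by (simp add: integral_distr integral_density flip: integral_divide_zero)
  qed
  show ?thesis
  proof (cases "c = 0")
    case True
    have "(\<integral>f. W f * indicator B (\<psi> f) \<partial>L) = 0"
      if sL[measurable_cong]: "sets L = sets M" and L: "integrable L W" "c = (\<integral>f. W f \<partial>L)" for L
    proof -
      have "AE f in L. W f = 0"
        using L True W_bounds by (subst integral_nonneg_eq_0_iff_AE[symmetric]) auto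
      then show ?thesis
        by (intro integral_eq_zero_AE) auto
    qed
    then show ?thesis using intM intN sets c_N c_def by metis
  next
    case False
    then have c: "c > 0" using c_nonneg by simp
    note DM = dens[OF c refl intM c_def] and DN = dens[OF c sets intN c_N]
    have "distr (density M (\<lambda>f. W f / c)) borel \<psi> = distr (density N (\<lambda>f. W f / c)) borel \<psi>"
    proof (rule Levy_uniqueness)
      show "char (distr (density M (\<lambda>f. W f / c)) borel \<psi>) = char (distr (density N (\<lambda>f. W f / c)) borel \<psi>)"
      proof
        fix t
        have [measurable]: "(\<lambda>x. iexp (t * x)) \<in> borel_measurable borel" by simp
        show "char (distr (density M (\<lambda>f. W f / c)) borel \<psi>) t = char (distr (density N (\<lambda>f. W f / c)) borel \<psi>) t"
          unfolding char_def using DM DN eq[of t] by simp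
      qed
    qed (use DM DN in auto)
    moreover have "(indicator B :: real \<Rightarrow> real) \<in> borel_measurable borel" by simp
    ultimately have "(\<integral>f. W f *\<^sub>R indicator B (\<psi> f) \<partial>M) / c = (\<integral>f. W f *\<^sub>R indicator B (\<psi> f) \<partial>N) / c"
      using DM DN by metis
    with c show ?thesis by simp
  qed
qed

text \<open>
  The inductive step of the Cramer-Wold device. The factor \<open>iexp (\<phi> f)\<close> is complex, so it cannot be
  absorbed into a weight directly; but for \<open>norm z \<le> 1\<close> the function \<open>1 + Re (z * iexp (\<phi> f))\<close> is
  nonnegative, and as a combination of \<open>1\<close>, \<open>iexp (\<phi> f)\<close> and its conjugate its products with
  \<open>iexp (t * \<psi> f)\<close> only involve exponents from the vector space \<open>\<Phi>\<close>. The values \<open>0\<close>, \<open>1\<close> and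
  \<open>- \<i>\<close> of \<open>z\<close> recover the mass, the real part and the imaginary part.
\<close>

lemma integral_indicator_iexp_eqI:
  fixes W :: "'a \<Rightarrow> real" and \<Phi> :: "('a \<Rightarrow> real) set"
  assumes M: "finite_measure M" and N: "finite_measure N" and sets: "sets N = sets M"
    and W[measurable]: "W \<in> borel_measurable M"
    and W_bounds: "\<And>f. 0 \<le> W f" "\<And>f. W f \<le> 1"
    and \<Phi>: "\<Phi> \<subseteq> borel_measurable M"
    and lin: "\<And>\<phi> \<psi> s t. \<phi> \<in> \<Phi> \<Longrightarrow> \<psi> \<in> \<Phi> \<Longrightarrow> (\<lambda>f. s * \<phi> f + t * \<psi> f) \<in> \<Phi>"
    and eq: "\<And>\<phi>. \<phi> \<in> \<Phi> \<Longrightarrow> (\<integral>f. W f *\<^sub>R iexp (\<phi> f) \<partial>M) = (\<integral>f. W f *\<^sub>R iexp (\<phi> f) \<partial>N)"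
    and \<psi>: "\<psi> \<in> \<Phi>" and \<phi>: "\<phi> \<in> \<Phi>"
    and B[measurable]: "B \<in> sets borel"
  shows "(\<integral>f. (W f * indicator B (\<psi> f)) *\<^sub>R iexp (\<phi> f) \<partial>M) = (\<integral>f. (W f * indicator B (\<psi> f)) *\<^sub>R iexp (\<phi> f) \<partial>N)"
proof -
  interpret M: finite_measure M by fact
  interpret N: finite_measure N by fact
  note [measurable_cong] = sets
  have [measurable]: "\<psi> \<in> borel_measurable M" "\<phi> \<in> borel_measurable M"
    using \<psi> \<phi> \<Phi> by auto
  have *: "(\<integral>f. (W f * (1 + Re (z * iexp (\<phi> f)))) * indicator B (\<psi> f) \<partial>M) =
      (\<integral>f. (W f * (1 + Re (z * iexp (\<phi> f)))) * indicator B (\<psi> f) \<partial>N)" if z: "norm z \<le> 1" for z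
  proof (rule integral_weight_indicator_eqI[OF M N sets, where C = 2])
    have bd: "\<bar>Re (z * iexp x)\<bar> \<le> 1" for x
      using abs_Re_le_cmod[of "z * iexp x"] z by (simp add: norm_mult)
    show "0 \<le> W f * (1 + Re (z * iexp (\<phi> f)))" for f
      using bd[of "\<phi> f"] W_bounds[of f] by (intro mult_nonneg_nonneg) auto
    show "W f * (1 + Re (z * iexp (\<phi> f))) \<le> 2" for f
      using bd[of "\<phi> f"] W_bounds[of f] mult_mono[of "W f" 1 "1 + Re (z * iexp (\<phi> f))" 2] by auto
    fix t
    \<comment> \<open>Euler's formula; the exponents are written as members of \<open>\<Phi>\<close>.\<close>
    have expand: "(W f * (1 + Re (z * iexp (\<phi> f)))) *\<^sub>R iexp (t * \<psi> f) =
       W f *\<^sub>R iexp (0 * \<phi> f + t * \<psi> f) + z / 2 * (W f *\<^sub>R iexp (1 * \<phi> f + t * \<psi> f))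
         + cnj z / 2 * (W f *\<^sub>R iexp ((-1) * \<phi> f + t * \<psi> f))" for f
    proof -
      have re: "complex_of_real (Re (z * iexp (\<phi> f))) = (z * iexp (\<phi> f) + cnj z * iexp (- \<phi> f)) / 2"
        using complex_add_cnj[of "z * iexp (\<phi> f)"] by (simp add: exp_cnj del: complex_add_cnj)
      have e1: "iexp (1 * \<phi> f + t * \<psi> f) = iexp (\<phi> f) * iexp (t * \<psi> f)"
        and e2: "iexp ((-1) * \<phi> f + t * \<psi> f) = iexp (- \<phi> f) * iexp (t * \<psi> f)"
        by (simp_all add: algebra_simps flip: exp_add)
      have alg: "w * (1 + (z * a + c * b) / 2) * E = w * E + z / 2 * (w * (a * E)) + c / 2 * (w * (b * E))"
        for w a b c E :: complex
        by (simp add: field_simps)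
      show ?thesis
        unfolding e1 e2 scaleR_conv_of_real of_real_mult[of "W f"] of_real_add[of 1] of_real_1 re alg by simp
    qed
    have int: "integrable L (\<lambda>f. W f *\<^sub>R iexp (s * \<phi> f + t * \<psi> f))"
      if [measurable_cong]: "sets L = sets M" and "finite_measure L" for s L
    proof -
      interpret finite_measure L by fact
      show ?thesis
        by (rule integrable_const_bound[where B = 1]) (use W_bounds in \<open>auto simp: norm_mult simp flip: of_real_mult of_real_add\<close>)
    qed
    have split: "(\<integral>f. (W f * (1 + Re (z * iexp (\<phi> f)))) *\<^sub>R iexp (t * \<psi> f) \<partial>L) =
       (\<integral>f. W f *\<^sub>R iexp (0 * \<phi> f + t * \<psi> f) \<partial>L) + z / 2 * (\<integral>f. W f *\<^sub>R iexp (1 * \<phi> f + t * \<psi> f) \<partial>L)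
         + cnj z / 2 * (\<integral>f. W f *\<^sub>R iexp ((-1) * \<phi> f + t * \<psi> f) \<partial>L)"
      if "sets L = sets M" and "finite_measure L" for L
    proof -
      have sum3: "(\<integral>f. a f + u * b f + v * d f \<partial>L) = (\<integral>f. a f \<partial>L) + u * (\<integral>f. b f \<partial>L) + v * (\<integral>f. d f \<partial>L)"
        if "integrable L a" "integrable L b" "integrable L d" for a b d :: "'a \<Rightarrow> complex" and u v
        using that by simp
      show ?thesis
        unfolding expand by (rule sum3[OF int int int]) fact+
    qed
    show "(\<integral>f. (W f * (1 + Re (z * iexp (\<phi> f)))) *\<^sub>R iexp (t * \<psi> f) \<partial>M) =
      (\<integral>f. (W f * (1 + Re (z * iexp (\<phi> f)))) *\<^sub>R iexp (t * \<psi> f) \<partial>N)"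
      using split[OF refl M] split[OF sets N] eq[OF lin[OF \<phi> \<psi>]] by metis
  qed auto
  define V where "V f = W f * indicator B (\<psi> f)" for f
  have V[measurable]: "V \<in> borel_measurable M" unfolding V_def by measurable
  have V_bounds: "0 \<le> V f" "V f \<le> 1" for f
    using W_bounds[of f] by (auto simp: V_def split: split_indicator)
  have intV: "integrable L (\<lambda>f. V f *\<^sub>R iexp (\<phi> f))" "integrable L V"
    if [measurable_cong]: "sets L = sets M" and "finite_measure L" for L
  proof -
    interpret finite_measure L by fact
    show "integrable L (\<lambda>f. V f *\<^sub>R iexp (\<phi> f))" "integrable L V"
      by (rule integrable_const_bound[where B = 1]; use V_bounds in \<open>auto simp: norm_mult\<close>)+
  qed
  have split: "(\<integral>f. (W f * (1 + Re (z * iexp (\<phi> f)))) * indicator B (\<psi> f) \<partial>L) =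
      (\<integral>f. V f \<partial>L) + Re (z * (\<integral>f. V f *\<^sub>R iexp (\<phi> f) \<partial>L))"
    if L: "sets L = sets M" "finite_measure L" for z L
  proof -
    have "(\<integral>f. (W f * (1 + Re (z * iexp (\<phi> f)))) * indicator B (\<psi> f) \<partial>L)
      = (\<integral>f. V f + Re (z * (V f *\<^sub>R iexp (\<phi> f))) \<partial>L)"
      by (intro Bochner_Integration.integral_cong) (auto simp: V_def algebra_simps)
    also have "\<dots> = (\<integral>f. V f \<partial>L) + (\<integral>f. Re (z * (V f *\<^sub>R iexp (\<phi> f))) \<partial>L)"
      using intV[OF L] by (intro Bochner_Integration.integral_add integrable_Re integrable_mult_right) auto
    also have "(\<integral>f. Re (z * (V f *\<^sub>R iexp (\<phi> f))) \<partial>L) = Re (\<integral>f. z * (V f *\<^sub>R iexp (\<phi> f)) \<partial>L)"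
      using intV[OF L] by (intro integral_Re integrable_mult_right)
    finally show ?thesis by (simp only: integral_mult_right_zero)
  qed
  have key: "(\<integral>f. V f \<partial>M) + Re (z * (\<integral>f. V f *\<^sub>R iexp (\<phi> f) \<partial>M)) =
     (\<integral>f. V f \<partial>N) + Re (z * (\<integral>f. V f *\<^sub>R iexp (\<phi> f) \<partial>N))" if "norm z \<le> 1" for z
    using *[OF that] unfolding split[OF refl M] split[OF sets N] .
  show ?thesis
    unfolding V_def[symmetric] using key[of 0] key[of 1] key[of "- \<i>"] by (simp add: complex_eq_iff)
qed

text \<open>
  By induction on \<open>J'\<close>, the products of indicators over \<open>J' \<subseteq> J\<close> can be put in front of \<open>iexp (\<phi> f)\<close>
  for every \<open>\<phi> \<in> \<Phi>\<close>. Keeping \<open>\<phi>\<close> arbitrary is what makes the induction work, because each step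
  uses up exponentials of other members of \<open>\<Phi>\<close>; at the end \<open>\<phi> = 0\<close>.
\<close>

lemma measure_Inter_vimage_eqI:
  fixes X :: "'i \<Rightarrow> 'a \<Rightarrow> real"
  assumes M: "finite_measure M" and N: "finite_measure N" and sets: "sets N = sets M"
    and \<Phi>: "\<Phi> \<subseteq> borel_measurable M"
    and lin: "\<And>\<phi> \<psi> s t. \<phi> \<in> \<Phi> \<Longrightarrow> \<psi> \<in> \<Phi> \<Longrightarrow> (\<lambda>f. s * \<phi> f + t * \<psi> f) \<in> \<Phi>"
    and eq: "\<And>\<phi>. \<phi> \<in> \<Phi> \<Longrightarrow> (\<integral>f. iexp (\<phi> f) \<partial>M) = (\<integral>f. iexp (\<phi> f) \<partial>N)"
    and zero: "(\<lambda>f. 0) \<in> \<Phi>"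
    and J: "finite J" "\<And>j. j \<in> J \<Longrightarrow> X j \<in> \<Phi>" "\<And>j. j \<in> J \<Longrightarrow> B j \<in> sets borel"
  shows "measure M {f \<in> space M. \<forall>j\<in>J. X j f \<in> B j} = measure N {f \<in> space N. \<forall>j\<in>J. X j f \<in> B j}"
proof -
  note [measurable_cong] = sets
  have meas: "X j \<in> borel_measurable M" if "j \<in> J" for j
    using J(2)[OF that] \<Phi> by blast
  have "(\<integral>f. (\<Prod>j\<in>J'. indicator (B j) (X j f)) *\<^sub>R iexp (\<phi> f) \<partial>M) =
     (\<integral>f. (\<Prod>j\<in>J'. indicator (B j) (X j f)) *\<^sub>R iexp (\<phi> f) \<partial>N)"
    if "J' \<subseteq> J" "\<phi> \<in> \<Phi>" for J' \<phi>
    using finite_subset[OF that(1) J(1)] that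
  proof (induction J' arbitrary: \<phi> rule: finite_induct)
    case empty
    then show ?case using eq by simp
  next
    case (insert l J')
    define W where "W f = (\<Prod>j\<in>J'. indicator (B j) (X j f) :: real)" for f
    have [measurable]: "W \<in> borel_measurable M"
      unfolding W_def using insert.prems
      by (intro borel_measurable_prod measurable_compose[OF meas borel_measurable_indicator[OF J(3)]]) auto
    have W_bounds: "0 \<le> W f" "W f \<le> 1" for f
      unfolding W_def by (auto intro!: prod_nonneg prod_le_1 simp: indicator_def)
    have prod: "(\<Prod>j\<in>insert l J'. indicator (B j) (X j f)) = W f * indicator (B l) (X l f)" for f
      using insert.hyps by (simp add: W_def mult.commute)
    show ?case
      unfolding prod
    proof (rule integral_indicator_iexp_eqI[OF M N sets _ W_bounds \<Phi>])
      fix \<phi> assume "\<phi> \<in> \<Phi>"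
      then show "(\<integral>f. W f *\<^sub>R iexp (\<phi> f) \<partial>M) = (\<integral>f. W f *\<^sub>R iexp (\<phi> f) \<partial>N)"
        unfolding W_def using insert.prems by (intro insert.IH) auto
    qed (use insert.prems J lin in auto)
  qed
  from this[OF order_refl zero]
  have "complex_of_real (\<integral>f. (\<Prod>j\<in>J. indicator (B j) (X j f)) \<partial>M) = of_real (\<integral>f. (\<Prod>j\<in>J. indicator (B j) (X j f)) \<partial>N)"
    by (simp add: scaleR_conv_of_real del: of_real_prod)
  then have "(\<integral>f. (\<Prod>j\<in>J. indicator (B j) (X j f)) \<partial>M) = (\<integral>f. (\<Prod>j\<in>J. indicator (B j) (X j f) :: real) \<partial>N)"
    using of_real_eq_iff by blast
  moreover have "(\<integral>f. (\<Prod>j\<in>J. indicator (B j) (X j f) :: real) \<partial>L) = measure L {f \<in> space L. \<forall>j\<in>J. X j f \<in> B j}"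
    for L
  proof -
    have "(\<Prod>j\<in>J. indicator (B j) (X j f) :: real) = indicator {f \<in> space L. \<forall>j\<in>J. X j f \<in> B j} f" if "f \<in> space L" for f
      using J(1) that by (auto simp: indicator_def intro!: prod.neutral prod_zero)
    then have "(\<integral>f. (\<Prod>j\<in>J. indicator (B j) (X j f) :: real) \<partial>L) =
        (\<integral>f. indicator {f \<in> space L. \<forall>j\<in>J. X j f \<in> B j} f \<partial>L)"
      by (intro Bochner_Integration.integral_cong refl)
    then show ?thesis
      by (simp add: Int_absorb2 subset_eq)
  qed
  ultimately show ?thesis by simp
qed

section \<open>Measures on the function space\<close>

lemma space_fun_space: "space (fun_space X Y) = fun_carrier X Y"
  unfolding fun_space_def by (rule space_measure_of) auto

lemma measurable_fun_space_eval:
  assumes "z \<in> space X"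
  shows "(\<lambda>f. f z) \<in> measurable (fun_space X Y) Y"
proof (rule measurableI)
  show "f z \<in> space Y" if "f \<in> space (fun_space X Y)" for f
    using that assms measurable_space[of f X Y z] by (simp add: space_fun_space fun_carrier_def)
next
  fix B assume "B \<in> sets Y"
  have "(\<lambda>f. f z) -` B \<inter> space (fun_space X Y) = {f \<in> fun_carrier X Y. f z \<in> B}"
    by (auto simp: space_fun_space)
  also have "\<dots> \<in> sets (fun_space X Y)"
    unfolding fun_space_def using assms \<open>B \<in> sets Y\<close> by (intro in_measure_of) auto
  finally show "(\<lambda>f. f z) -` B \<inter> space (fun_space X Y) \<in> sets (fun_space X Y)" .
qed

text \<open>
  The generating sets constrain the value at a single point and are not closed under intersection.
  Uniqueness of measures is therefore applied to the finite-dimensional cylinders \<open>E\<close>, on which the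
  Cramer-Wold device, with the linear span of the evaluations as \<open>\<Phi>\<close>, gives agreement.
\<close>

lemma fun_space_measure_eqI:
  assumes P: "prob_space P" "sets P = sets (fun_space X borel)"
    and Q: "prob_space Q" "sets Q = sets (fun_space X borel)"
    and eq: "\<And>K a. finite K \<Longrightarrow> K \<subseteq> space X \<Longrightarrow>
      (\<integral>f. iexp (\<Sum>i\<in>K. a i * f i) \<partial>P) = (\<integral>f. iexp (\<Sum>i\<in>K. a i * f i) \<partial>Q)"
  shows "P = Q"
proof -
  interpret P: prob_space P by fact
  interpret Q: prob_space Q by fact
  have spaces: "space P = fun_carrier X borel" "space Q = fun_carrier X borel"
    using P(2) Q(2) by (auto dest!: sets_eq_imp_space_eq simp: space_fun_space)
  define \<Phi> :: "(('a \<Rightarrow> real) \<Rightarrow> real) set"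
    where "\<Phi> = {(\<lambda>f. \<Sum>i\<in>K. a i * f i) | K a. finite K \<and> K \<subseteq> space X}"
  define E where "E = {{f \<in> fun_carrier X borel. \<forall>j\<in>J. f j \<in> B j} | J (B :: 'a \<Rightarrow> real set).
    finite J \<and> J \<subseteq> space X \<and> (\<forall>j\<in>J. B j \<in> sets borel)}"
  have eval: "(\<lambda>f. f z) \<in> borel_measurable (fun_space X borel)" if "z \<in> space X" for z
    using measurable_fun_space_eval[OF that] .
  have E_sets: "{f \<in> fun_carrier X borel. \<forall>j\<in>J. f j \<in> B j} \<in> sets (fun_space X borel)"
    if "finite J" "J \<subseteq> space X" "\<forall>j\<in>J. B j \<in> sets borel" for J and B :: "'a \<Rightarrow> real set"
  proof -
    have "{f \<in> space (fun_space X borel). \<forall>j\<in>J. f j \<in> B j} \<in> sets (fun_space X borel)"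
    proof (rule sets.sets_Collect_finite_All)
      fix j assume "j \<in> J"
      then show "{f \<in> space (fun_space X borel). f j \<in> B j} \<in> sets (fun_space X borel)"
        using that by (intro measurable_sets_Collect[OF eval]) auto
    qed fact
    then show ?thesis by (simp only: space_fun_space)
  qed
  have "sets (fun_space X borel) = sigma_sets (fun_carrier X borel)
      {{f \<in> fun_carrier X borel. f z \<in> B} | z (B :: real set). z \<in> space X \<and> B \<in> sets borel}"
    (is "_ = sigma_sets ?\<Omega> ?G")
    unfolding fun_space_def by (rule sets_measure_of) auto
  moreover have "sigma_sets ?\<Omega> ?G \<subseteq> sigma_sets ?\<Omega> E"
  proof (rule sigma_sets_mono')
    show "?G \<subseteq> E"
    proof
      fix C assume "C \<in> ?G"
      then obtain z and B :: "real set" where "C = {f \<in> ?\<Omega>. f z \<in> B}" "z \<in> space X" "B \<in> sets borel"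
        by auto
      then show "C \<in> E"
        unfolding E_def by (intro CollectI exI[of _ "{z}"] exI[of _ "\<lambda>_. B"]) simp
    qed
  qed
  moreover have "sigma_sets ?\<Omega> E \<subseteq> sets (fun_space X borel)"
    using E_sets sets.sigma_sets_subset[of E "fun_space X borel"]
    by (auto simp: E_def space_fun_space)
  ultimately have gen: "sets (fun_space X borel) = sigma_sets ?\<Omega> E"
    by auto
  have measure_eq: "measure P {f \<in> space P. \<forall>j\<in>J. f j \<in> B j} = measure Q {f \<in> space Q. \<forall>j\<in>J. f j \<in> B j}"
    if J: "finite J" "J \<subseteq> space X" "\<And>j. j \<in> J \<Longrightarrow> B j \<in> sets borel" for J and B :: "'a \<Rightarrow> real set"
  proof (rule measure_Inter_vimage_eqI[where \<Phi> = \<Phi>])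
    show "finite_measure P" "finite_measure Q" "sets Q = sets P"
      using P Q by (auto intro: P.finite_measure_axioms Q.finite_measure_axioms)
    show "\<Phi> \<subseteq> borel_measurable P"
    proof
      fix \<phi> assume "\<phi> \<in> \<Phi>"
      then obtain K a where \<phi>: "\<phi> = (\<lambda>f. \<Sum>i\<in>K. a i * f i)" "K \<subseteq> space X"
        unfolding \<Phi>_def by auto
      show "\<phi> \<in> borel_measurable P"
        unfolding \<phi> measurable_cong_sets[OF P(2) refl] using \<phi>(2)
        by (intro borel_measurable_sum borel_measurable_times borel_measurable_const eval) auto
    qed
    show "(\<lambda>f. s * \<phi> f + t * \<psi> f) \<in> \<Phi>" if \<phi>\<psi>: "\<phi> \<in> \<Phi>" "\<psi> \<in> \<Phi>" for \<phi> \<psi> s t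
    proof -
      obtain K a where \<phi>: "\<phi> = (\<lambda>f. \<Sum>i\<in>K. a i * f i)" "finite K" "K \<subseteq> space X"
        using \<phi>\<psi>(1) unfolding \<Phi>_def by blast
      obtain L b where \<psi>: "\<psi> = (\<lambda>f. \<Sum>i\<in>L. b i * f i)" "finite L" "L \<subseteq> space X"
        using \<phi>\<psi>(2) unfolding \<Phi>_def by blast
      define d where "d i = s * (if i \<in> K then a i else 0) + t * (if i \<in> L then b i else 0)" for i
      \<comment> \<open>Extending the coefficients by zero puts both sums over the same index set.\<close>
      have ext: "(\<Sum>i\<in>S. r i * f i) = (\<Sum>i\<in>K \<union> L. (if i \<in> S then r i else 0) * f i)"
        if "S \<subseteq> K \<union> L" for S r and f :: "'a \<Rightarrow> real"
        using that \<phi>(2) \<psi>(2) by (intro sum.mono_neutral_cong_left) auto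
      have "s * \<phi> f + t * \<psi> f = (\<Sum>i\<in>K \<union> L. d i * f i)" for f
        unfolding \<phi>(1) \<psi>(1)
        by (subst (1 2) ext) (simp_all only: d_def sum_distrib_left sum.distrib distrib_right mult.assoc Un_upper1 Un_upper2)
      then show ?thesis
        unfolding \<Phi>_def using \<phi> \<psi> by (intro CollectI exI[of _ "K \<union> L"] exI[of _ d]) auto
    qed
    show "(\<integral>f. iexp (\<phi> f) \<partial>P) = (\<integral>f. iexp (\<phi> f) \<partial>Q)" if "\<phi> \<in> \<Phi>" for \<phi>
      using that eq unfolding \<Phi>_def by auto
    show "(\<lambda>f. 0) \<in> \<Phi>"
      unfolding \<Phi>_def by (intro CollectI exI[of _ "{}"]) auto
    show "(\<lambda>f. f j) \<in> \<Phi>" if "j \<in> J" for j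
      unfolding \<Phi>_def using that J by (intro CollectI exI[of _ "{j}"] exI[of _ "\<lambda>_. 1"]) auto
  qed (use J in auto)
  show ?thesis
  proof (rule measure_eqI_generator_eq)
    show "E \<subseteq> Pow ?\<Omega>" unfolding E_def by auto
    show "sets P = sigma_sets ?\<Omega> E" "sets Q = sigma_sets ?\<Omega> E"
      using P Q gen by auto
    show "emeasure P C = emeasure Q C" if "C \<in> E" for C
      using that measure_eq unfolding E_def
      by (auto simp: P.emeasure_eq_measure Q.emeasure_eq_measure spaces)
    show "range (\<lambda>_::nat. ?\<Omega>) \<subseteq> E"
      unfolding E_def by (auto intro!: exI[of _ "{}"])
    show "Int_stable E"
    proof (rule Int_stableI)
      fix C D assume "C \<in> E" "D \<in> E"
      then obtain J A L B where
        C: "C = {f \<in> ?\<Omega>. \<forall>j\<in>J. f j \<in> A j}" "finite J" "J \<subseteq> space X" "\<forall>j\<in>J. A j \<in> sets borel" and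
        D: "D = {f \<in> ?\<Omega>. \<forall>j\<in>L. f j \<in> B j}" "finite L" "L \<subseteq> space X" "\<forall>j\<in>L. B j \<in> sets borel"
        unfolding E_def by blast
      let ?B = "\<lambda>j. (if j \<in> J then A j else UNIV) \<inter> (if j \<in> L then B j else UNIV)"
      have "C \<inter> D = {f \<in> ?\<Omega>. \<forall>j\<in>J \<union> L. f j \<in> ?B j}"
        unfolding C(1) D(1) by auto
      then show "C \<inter> D \<in> E"
        unfolding E_def using C D by (intro CollectI exI[of _ "J \<union> L"] exI[of _ ?B]) auto
    qed
  qed (auto simp: P.emeasure_eq_measure)
qed

section \<open>Normal distributions and linear combinations of Gaussian coordinates\<close>

text \<open>
  As an affine image of the standard normal law, the degenerate case \<open>\<sigma> = 0\<close> needs no separate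
  treatment in the computation of moments and characteristic functions below.
\<close>

lemma normal_distribution_eq_distr:
  assumes "0 \<le> \<sigma>"
  shows "normal_distribution \<mu> \<sigma> = distr std_normal_distribution borel (\<lambda>x. \<mu> + \<sigma> * x)"
proof (cases "\<sigma> = 0")
  case True
  interpret real_distribution std_normal_distribution by (rule real_dist_normal_dist)
  show ?thesis
    using True by (simp add: normal_distribution_def distr_const)
next
  case False
  interpret real_distribution std_normal_distribution by (rule real_dist_normal_dist)
  have "distributed std_normal_distribution lborel (\<lambda>x. x) std_normal_density"
    unfolding distributed_def by (auto simp: distr_id2)
  from normal_density_affine[OF this, of \<sigma> \<mu>] False assms
  have "density lborel (normal_density \<mu> \<sigma>) = distr std_normal_distribution lborel (\<lambda>x. \<mu> + \<sigma> * x)"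
    by (simp add: distributed_def)
  also have "\<dots> = distr std_normal_distribution borel (\<lambda>x. \<mu> + \<sigma> * x)"
    by (intro distr_cong) auto
  finally show ?thesis
    using False by (simp add: normal_distribution_def)
qed

lemma
  assumes "0 \<le> \<sigma>"
  shows integrable_normal_distribution: "integrable (normal_distribution \<mu> \<sigma>) (\<lambda>x. x)"
    and integrable_square_normal_distribution: "integrable (normal_distribution \<mu> \<sigma>) (\<lambda>x. x\<^sup>2)"
    and mean_normal_distribution: "(\<integral>x. x \<partial>normal_distribution \<mu> \<sigma>) = \<mu>"
    and variance_normal_distribution: "(\<integral>x. (x - \<mu>)\<^sup>2 \<partial>normal_distribution \<mu> \<sigma>) = \<sigma>\<^sup>2"
    and char_normal_distribution: "char (normal_distribution \<mu> \<sigma>) t = iexp (t * \<mu>) * exp (- (t * \<sigma>)\<^sup>2 / 2)"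
proof -
  let ?S = std_normal_distribution
  interpret real_distribution ?S by (rule real_dist_normal_dist)
  have m: "(\<integral>x. x \<partial>?S) = 0" "(\<integral>x. x\<^sup>2 \<partial>?S) = 1"
    using integral_std_normal_distribution_moment_odd[of 1] std_normal_distribution_even_moments[of 1] by simp_all
  have one: "(\<integral>x. c \<partial>?S) = c" for c :: real
    using prob_space by simp
  note eq = normal_distribution_eq_distr[OF assms]
  have int: "integrable ?S (\<lambda>x. x)" "integrable ?S (\<lambda>x. x\<^sup>2)"
    using integrable_std_normal_distribution_moment[of 1] integrable_std_normal_distribution_moment[of 2]
    by simp_all
  have distr: "(\<integral>x. g x \<partial>normal_distribution \<mu> \<sigma>) = (\<integral>x. g (\<mu> + \<sigma> * x) \<partial>?S)"
      "integrable (normal_distribution \<mu> \<sigma>) g \<longleftrightarrow> integrable ?S (\<lambda>x. g (\<mu> + \<sigma> * x))"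
    if "g \<in> borel_measurable borel" for g :: "real \<Rightarrow> real"
    unfolding eq using that by (auto intro!: integral_distr integrable_distr_eq)
  show "integrable (normal_distribution \<mu> \<sigma>) (\<lambda>x. x)"
    by (rule distr(2)[THEN iffD2, OF measurable_ident_sets[OF refl]])
       (intro Bochner_Integration.integrable_add integrable_mult_right integrable_const int)
  have "(\<mu> + \<sigma> * x)\<^sup>2 = \<mu>\<^sup>2 + (\<sigma>\<^sup>2 * x\<^sup>2 + 2 * \<mu> * \<sigma> * x)" for x
    by (simp add: power2_eq_square algebra_simps)
  moreover have "integrable ?S (\<lambda>x. \<mu>\<^sup>2 + (\<sigma>\<^sup>2 * x\<^sup>2 + 2 * \<mu> * \<sigma> * x))"
    using int by (intro Bochner_Integration.integrable_add integrable_mult_right integrable_const)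
  ultimately have "integrable ?S (\<lambda>x. (\<mu> + \<sigma> * x)\<^sup>2)"
    by (simp only:)
  then show "integrable (normal_distribution \<mu> \<sigma>) (\<lambda>x. x\<^sup>2)"
    by (rule distr(2)[THEN iffD2, rotated]) simp
  have "(\<integral>x. \<mu> + \<sigma> * x \<partial>?S) = (\<integral>x. \<mu> \<partial>?S) + (\<integral>x. \<sigma> * x \<partial>?S)"
    using int by (intro Bochner_Integration.integral_add integrable_mult_right integrable_const)
  then show "(\<integral>x. x \<partial>normal_distribution \<mu> \<sigma>) = \<mu>"
    unfolding distr(1)[OF measurable_ident_sets[OF refl]] by (simp only: integral_mult_right_zero m one mult_zero_right add_0_right)
  have "(\<integral>x. (\<mu> + \<sigma> * x - \<mu>)\<^sup>2 \<partial>?S) = (\<integral>x. \<sigma>\<^sup>2 * x\<^sup>2 \<partial>?S)"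
    by (simp only: add_diff_cancel_left' power_mult_distrib)
  also have "\<dots> = \<sigma>\<^sup>2 * (\<integral>x. x\<^sup>2 \<partial>?S)"
    by (rule integral_mult_right_zero)
  finally show "(\<integral>x. (x - \<mu>)\<^sup>2 \<partial>normal_distribution \<mu> \<sigma>) = \<sigma>\<^sup>2"
    by (subst distr(1)) (simp_all only: m mult_1_right, simp)
  have "char (normal_distribution \<mu> \<sigma>) t = (\<integral>x. iexp (t * \<mu>) * iexp ((t * \<sigma>) * x) \<partial>?S)"
    unfolding eq char_def exp_add[symmetric] by (subst integral_distr) (simp_all add: algebra_simps)
  also have "\<dots> = iexp (t * \<mu>) * char ?S (t * \<sigma>)"
    unfolding char_def by (rule integral_mult_right_zero)
  finally show "char (normal_distribution \<mu> \<sigma>) t = iexp (t * \<mu>) * exp (- (t * \<sigma>)\<^sup>2 / 2)"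
    by (simp only: char_std_normal_distribution of_real_exp)
qed

text \<open>
  The definition leaves the parameters of the normal law of a linear combination open. They are
  identified by computing its mean and variance from the moments of the coordinates; the single coordinates, being normal themselves, are
  square integrable, which justifies integrating the expanded square term by term.
\<close>

lemma multivariate_gaussian_linear_combination:
  assumes Q: "multivariate_gaussian I Q m K" and I: "finite I"
  shows "0 \<le> (\<Sum>i\<in>I. \<Sum>j\<in>I. a i * a j * K i j)"
    and "distr Q borel (\<lambda>f. \<Sum>i\<in>I. a i * f i) =
      normal_distribution (\<Sum>i\<in>I. a i * m i) (sqrt (\<Sum>i\<in>I. \<Sum>j\<in>I. a i * a j * K i j))"
proof -
  have "prob_space Q" and sets[measurable_cong]: "sets Q = sets (PiM I (\<lambda>_. borel))"
    and normal: "\<And>a. \<exists>\<mu> \<sigma>. 0 \<le> \<sigma> \<and> distr Q borel (\<lambda>f. \<Sum>i\<in>I. a i * f i) = normal_distribution \<mu> \<sigma>"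
    and mean: "\<And>i. i \<in> I \<Longrightarrow> (\<integral>f. f i \<partial>Q) = m i"
    and cov: "\<And>i j. i \<in> I \<Longrightarrow> j \<in> I \<Longrightarrow> (\<integral>f. (f i - m i) * (f j - m j) \<partial>Q) = K i j"
    using Q unfolding multivariate_gaussian_def by auto
  interpret prob_space Q by fact
  have [measurable]: "(\<lambda>f. f i) \<in> borel_measurable Q" if "i \<in> I" for i
    using that by measurable
  have sq: "integrable Q (\<lambda>f. f i) \<and> integrable Q (\<lambda>f. (f i)\<^sup>2)" if i: "i \<in> I" for i
  proof -
    obtain \<mu> \<sigma> where *: "0 \<le> \<sigma>" "distr Q borel (\<lambda>f. \<Sum>j\<in>I. (if j = i then 1 else 0) * f j) = normal_distribution \<mu> \<sigma>"
      using normal[of "\<lambda>j. if j = i then 1 else 0"] by auto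
    have "(\<lambda>f. \<Sum>j\<in>I. (if j = i then 1 else 0) * f j) = (\<lambda>f. f i :: real)"
      using i I by (simp add: if_distrib[of "\<lambda>c. c * _"] cong: if_cong)
    with * integrable_normal_distribution[OF *(1), of \<mu>] integrable_square_normal_distribution[OF *(1), of \<mu>] i
    show ?thesis
      by (simp add: integrable_distr_eq flip: *(2))
  qed
  have int2: "integrable Q (\<lambda>f. (f i - m i) * (f j - m j))" if "i \<in> I" "j \<in> I" for i j
  proof -
    have sq': "integrable Q (\<lambda>f. (f i - m i)\<^sup>2)" if "i \<in> I" for i
      using sq[OF that] by (simp add: power2_diff)
    show ?thesis
    proof (rule Bochner_Integration.integrable_bound)
      show "integrable Q (\<lambda>f. (f i - m i)\<^sup>2 + (f j - m j)\<^sup>2)"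
        using sq' that by simp
      have "norm (u * v) \<le> norm (u\<^sup>2 + v\<^sup>2)" for u v :: real
      proof -
        have "0 \<le> \<bar>u\<bar> * \<bar>v\<bar>" "0 \<le> u\<^sup>2 + v\<^sup>2" by simp_all
        with sum_squares_bound[of "\<bar>u\<bar>" "\<bar>v\<bar>"] show ?thesis
          unfolding real_norm_def abs_mult power2_abs by linarith
      qed
      then show "AE f in Q. norm ((f i - m i) * (f j - m j)) \<le> norm ((f i - m i)\<^sup>2 + (f j - m j)\<^sup>2)"
        by simp
    qed (use that in measurable)
  qed
  obtain \<mu> \<sigma> where \<sigma>: "0 \<le> \<sigma>" and N: "distr Q borel (\<lambda>f. \<Sum>i\<in>I. a i * f i) = normal_distribution \<mu> \<sigma>"
    using normal[of a] by auto
  have [measurable]: "(\<lambda>f. \<Sum>i\<in>I. a i * f i) \<in> borel_measurable Q"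
    by measurable
  have "\<mu> = (\<integral>f. (\<Sum>i\<in>I. a i * f i) \<partial>Q)"
    using mean_normal_distribution[OF \<sigma>, of \<mu>] by (simp add: integral_distr flip: N)
  also have "\<dots> = (\<Sum>i\<in>I. a i * m i)"
    using sq mean by (subst Bochner_Integration.integral_sum) auto
  finally have \<mu>: "\<mu> = (\<Sum>i\<in>I. a i * m i)" .
  have "\<sigma>\<^sup>2 = (\<integral>f. ((\<Sum>i\<in>I. a i * f i) - \<mu>)\<^sup>2 \<partial>Q)"
    using variance_normal_distribution[OF \<sigma>, of \<mu>] by (simp add: integral_distr flip: N)
  also have "\<dots> = (\<integral>f. (\<Sum>i\<in>I. \<Sum>j\<in>I. a i * a j * ((f i - m i) * (f j - m j))) \<partial>Q)"
  proof (intro Bochner_Integration.integral_cong refl)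
    fix f
    have "(\<Sum>i\<in>I. a i * f i) - \<mu> = (\<Sum>i\<in>I. a i * (f i - m i))"
      by (simp add: \<mu> sum_subtractf algebra_simps)
    then show "((\<Sum>i\<in>I. a i * f i) - \<mu>)\<^sup>2 = (\<Sum>i\<in>I. \<Sum>j\<in>I. a i * a j * ((f i - m i) * (f j - m j)))"
      by (simp add: power2_eq_square sum_product mult_ac)
  qed
  also have "\<dots> = (\<Sum>i\<in>I. \<Sum>j\<in>I. a i * a j * K i j)"
    using int2 cov by (simp add: Bochner_Integration.integral_sum)
  finally have var: "\<sigma>\<^sup>2 = (\<Sum>i\<in>I. \<Sum>j\<in>I. a i * a j * K i j)" .
  show "0 \<le> (\<Sum>i\<in>I. \<Sum>j\<in>I. a i * a j * K i j)"
    unfolding var[symmetric] by simp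
  show "distr Q borel (\<lambda>f. \<Sum>i\<in>I. a i * f i) =
      normal_distribution (\<Sum>i\<in>I. a i * m i) (sqrt (\<Sum>i\<in>I. \<Sum>j\<in>I. a i * a j * K i j))"
    using N \<sigma> by (simp flip: var \<mu>)
qed

lemma gaussian_process_linear_combination:
  assumes P: "gaussian_process X P m k" and K: "finite K" "K \<subseteq> space X"
  shows "0 \<le> (\<Sum>i\<in>K. \<Sum>j\<in>K. a i * a j * k i j)"
    and "distr P borel (\<lambda>f. \<Sum>i\<in>K. a i * f i) =
      normal_distribution (\<Sum>i\<in>K. a i * m i) (sqrt (\<Sum>i\<in>K. \<Sum>j\<in>K. a i * a j * k i j))"
    and "(\<integral>f. iexp (\<Sum>i\<in>K. a i * f i) \<partial>P) =
      iexp (\<Sum>i\<in>K. a i * m i) * exp (- (\<Sum>i\<in>K. \<Sum>j\<in>K. a i * a j * k i j) / 2)"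
proof -
  have sets[measurable_cong]: "sets P = sets (fun_space X borel)"
    and G: "multivariate_gaussian K (distr P (PiM K (\<lambda>_. borel)) (\<lambda>f. restrict f K)) m k"
    using assms unfolding gaussian_process_def by auto
  have [measurable]: "(\<lambda>f. f i) \<in> borel_measurable P" if "i \<in> K" for i
    using measurable_fun_space_eval[of i X borel] that K(2) by (auto simp: measurable_cong_sets[OF sets refl])
  have [measurable]: "(\<lambda>f. restrict f K) \<in> measurable P (PiM K (\<lambda>_. borel))"
    by (rule measurable_restrict) simp
  have [measurable]: "(\<lambda>f. \<Sum>i\<in>K. a i * f i) \<in> borel_measurable (PiM K (\<lambda>_. borel))"
    by measurable
  note lc = multivariate_gaussian_linear_combination[OF G K(1)]
  show nonneg: "0 \<le> (\<Sum>i\<in>K. \<Sum>j\<in>K. a i * a j * k i j)"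
    by (rule lc)
  show D: "distr P borel (\<lambda>f. \<Sum>i\<in>K. a i * f i) =
      normal_distribution (\<Sum>i\<in>K. a i * m i) (sqrt (\<Sum>i\<in>K. \<Sum>j\<in>K. a i * a j * k i j))"
    using lc(2)[of a] by (simp add: distr_distr comp_def)
  have "(\<integral>f. iexp (\<Sum>i\<in>K. a i * f i) \<partial>P) = char (distr P borel (\<lambda>f. \<Sum>i\<in>K. a i * f i)) 1"
    unfolding char_def by (subst integral_distr) auto
  then show "(\<integral>f. iexp (\<Sum>i\<in>K. a i * f i) \<partial>P) =
      iexp (\<Sum>i\<in>K. a i * m i) * exp (- (\<Sum>i\<in>K. \<Sum>j\<in>K. a i * a j * k i j) / 2)"
    unfolding D using nonneg by (subst (asm) char_normal_distribution) auto
qed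

section \<open>The prior as a mixture of the conditional processes\<close>

text \<open>
  Fubini's theorem for kernels. The complex case reduces to that of bounded real functions because
  every integral involved exists and hence commutes with real and imaginary parts.
\<close>

lemma integral_bind_complex:
  fixes g :: "'b \<Rightarrow> complex"
  assumes M: "prob_space M" and T: "T \<in> measurable M (prob_algebra N)"
    and g[measurable]: "g \<in> borel_measurable N" and bound: "\<And>f. norm (g f) \<le> 1"
  shows "(\<integral>f. g f \<partial>(M \<bind> T)) = (\<integral>y. (\<integral>f. g f \<partial>T y) \<partial>M)"
proof -
  interpret M: prob_space M by fact
  note T'[measurable] = measurable_prob_algebraD[OF T]
  have bind: "M \<bind> T = join (distr M (subprob_algebra N) T)"
    using T' M.not_empty by (rule bind_nonempty'')
  have real: "(\<integral>f. h f \<partial>(M \<bind> T)) = (\<integral>y. (\<integral>f. h f \<partial>T y) \<partial>M)"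
    if [measurable]: "h \<in> borel_measurable N" and "\<And>f. \<bar>h f\<bar> \<le> 1" for h :: "'b \<Rightarrow> real"
  proof -
    have "(\<integral>f. h f \<partial>(M \<bind> T)) = (\<integral>M'. integral\<^sup>L M' h \<partial>distr M (subprob_algebra N) T)"
      unfolding bind
    proof (rule integral_join[where B = 1 and B' = 1])
      show "finite_measure (distr M (subprob_algebra N) T)"
        by (intro M.finite_measure_distr T')
      show "AE M' in distr M (subprob_algebra N) T. emeasure M' (space M') \<le> ennreal 1"
        by (intro AE_I2) (auto simp: space_subprob_algebra subprob_space.emeasure_space_le_1)
    qed (use that in auto)
    also have "\<dots> = (\<integral>y. (\<integral>f. h f \<partial>T y) \<partial>M)"
      by (intro integral_distr) auto
    finally show ?thesis .
  qed
  have sets_T: "sets (T y) = sets N" and prob_T: "prob_space (T y)" if "y \<in> space M" for y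
    using measurable_space[OF T that] by (auto simp: space_prob_algebra)
  have int: "integrable (T y) g" if "y \<in> space M" for y
  proof -
    interpret prob_space "T y" by (rule prob_T) fact
    have "g \<in> borel_measurable (T y)"
      using g by (simp only: measurable_cong_sets[OF sets_T[OF that] refl])
    then show ?thesis
      by (intro integrable_const_bound[where B = 1]) (use bound in auto)
  qed
  have "prob_space (M \<bind> T)"
    using M T by (intro prob_space_bind'[where M = M]) (auto simp: space_prob_algebra)
  then interpret B: prob_space "M \<bind> T" .
  have sets_B: "sets (M \<bind> T) = sets N"
    using M T by (intro sets_bind'[where M = M]) (auto simp: space_prob_algebra)
  have "g \<in> borel_measurable (M \<bind> T)"
    using g by (simp only: measurable_cong_sets[OF sets_B refl])
  then have int_B: "integrable (M \<bind> T) g"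
    by (intro B.integrable_const_bound[where B = 1]) (use bound in auto)
  have int_M: "integrable M (\<lambda>y. \<integral>f. g f \<partial>T y)"
  proof (rule M.integrable_const_bound[where B = 1])
    show "AE y in M. norm (\<integral>f. g f \<partial>T y) \<le> 1"
    proof (rule AE_I2)
      fix y assume y: "y \<in> space M"
      interpret prob_space "T y" by (rule prob_T) fact
      have "norm (\<integral>f. g f \<partial>T y) \<le> (\<integral>f. norm (g f) \<partial>T y)"
        by (rule integral_norm_bound)
      also have "\<dots> \<le> (\<integral>f. 1 \<partial>T y)"
        using int[OF y] bound by (intro integral_mono) auto
      finally show "norm (\<integral>f. g f \<partial>T y) \<le> 1"
        using prob_space by simp
    qed
  qed measurable
  have "Re (\<integral>f. g f \<partial>(M \<bind> T)) = (\<integral>y. (\<integral>f. Re (g f) \<partial>T y) \<partial>M)"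
    unfolding integral_Re[OF int_B, symmetric]
    using bound order_trans[OF abs_Re_le_cmod] by (intro real) auto
  also have "\<dots> = Re (\<integral>y. (\<integral>f. g f \<partial>T y) \<partial>M)"
    unfolding integral_Re[OF int_M, symmetric]
    using int by (intro Bochner_Integration.integral_cong) auto
  finally have Re: "Re (\<integral>f. g f \<partial>(M \<bind> T)) = Re (\<integral>y. (\<integral>f. g f \<partial>T y) \<partial>M)" .
  have "Im (\<integral>f. g f \<partial>(M \<bind> T)) = (\<integral>y. (\<integral>f. Im (g f) \<partial>T y) \<partial>M)"
    unfolding integral_Im[OF int_B, symmetric]
    using bound order_trans[OF abs_Im_le_cmod] by (intro real) auto
  also have "\<dots> = Im (\<integral>y. (\<integral>f. g f \<partial>T y) \<partial>M)"
    unfolding integral_Im[OF int_M, symmetric]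
    using int by (intro Bochner_Integration.integral_cong) auto
  finally show ?thesis
    using Re by (simp add: complex_eq_iff)
qed

text \<open>
  The law of total probability for Gaussian processes: mixing the conditional processes over the
  prior law of \<open>f x\<close> gives back the prior. The proof compares the characteristic functions of linear
  combinations; \<open>c\<close> is the coefficient of the regression of \<open>\<Sum>i\<in>K. a i * f i\<close> on \<open>f x\<close>.
\<close>

lemma gaussian_process_bind_conditional:
  assumes P: "gaussian_process X P m k"
    and sym: "\<And>z. z \<in> space X \<Longrightarrow> k x z = k z x"
    and x: "x \<in> space X" "k x x > 0"
    and T: "T \<in> measurable borel (prob_algebra (fun_space X borel))"
    and G: "\<And>y. gaussian_process X (T y) (\<lambda>z. m z + k z x / k x x * (y - m x))
           (\<lambda>w z. k w z - k w x * k x z / k x x)"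
  shows "distr P borel (\<lambda>f. f x) \<bind> T = P"
proof -
  have "prob_space P" and sets_P[measurable_cong]: "sets P = sets (fun_space X borel)"
    using P by (auto simp: gaussian_process_def)
  interpret P: prob_space P by fact
  have [measurable]: "(\<lambda>f. f i) \<in> borel_measurable (fun_space X borel)" if "i \<in> space X" for i
    using measurable_fun_space_eval[OF that] .
  have eval_x: "(\<lambda>f. f x) \<in> borel_measurable P"
    using x(1) by measurable
  define \<nu> where "\<nu> = distr P borel (\<lambda>f. f x)"
  have \<nu>: "\<nu> = normal_distribution (m x) (sqrt (k x x))"
    unfolding \<nu>_def using gaussian_process_linear_combination(2)[OF P, of "{x}" "\<lambda>_. 1"] x by simp
  have prob_\<nu>: "prob_space \<nu>" and sets_\<nu>: "sets \<nu> = sets borel"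
    unfolding \<nu>_def using eval_x by (auto intro: P.prob_space_distr)
  have T\<nu>: "T \<in> measurable \<nu> (prob_algebra (fun_space X borel))"
    using T measurable_cong_sets[OF sets_\<nu> refl] by auto
  have \<nu>_in: "\<nu> \<in> space (prob_algebra \<nu>)"
    using prob_\<nu> by (simp add: space_prob_algebra)
  have "P = \<nu> \<bind> T"
  proof (rule fun_space_measure_eqI[OF \<open>prob_space P\<close> sets_P])
    show "prob_space (\<nu> \<bind> T)" "sets (\<nu> \<bind> T) = sets (fun_space X borel)"
      using prob_space_bind'[OF \<nu>_in T\<nu>] sets_bind'[OF \<nu>_in T\<nu>] by auto
    fix K :: "'a set" and a :: "'a \<Rightarrow> real"
    assume K: "finite K" "K \<subseteq> space X"
    define \<mu> where "\<mu> = (\<Sum>i\<in>K. a i * m i)"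
    define v where "v = (\<Sum>i\<in>K. \<Sum>j\<in>K. a i * a j * k i j)"
    define b where "b = (\<Sum>i\<in>K. a i * k i x)"
    define c where "c = b / k x x"
    have mean: "(\<Sum>i\<in>K. a i * (m i + k i x / k x x * (y - m x))) = \<mu> + c * (y - m x)" for y
      unfolding \<mu>_def c_def b_def sum_divide_distrib sum_distrib_right sum.distrib[symmetric]
      by (intro sum.cong refl) (simp add: distrib_left)
    have "(\<Sum>i\<in>K. \<Sum>j\<in>K. a i * a j * (k i j - k i x * k x j / k x x)) =
      v - (\<Sum>i\<in>K. \<Sum>j\<in>K. (a i * k i x) * (a j * k j x)) / k x x"
      unfolding v_def sum_divide_distrib sum_subtractf[symmetric]
      using sym K(2) by (intro sum.cong refl) (auto simp: right_diff_distrib)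
    also have "\<dots> = v - c\<^sup>2 * k x x"
      using x(2) unfolding sum_product[symmetric] b_def[symmetric] c_def by (simp add: power2_eq_square)
    finally have cov: "(\<Sum>i\<in>K. \<Sum>j\<in>K. a i * a j * (k i j - k i x * k x j / k x x)) = v - c\<^sup>2 * k x x" .
    have "(\<integral>f. iexp (\<Sum>i\<in>K. a i * f i) \<partial>(\<nu> \<bind> T)) = (\<integral>y. (\<integral>f. iexp (\<Sum>i\<in>K. a i * f i) \<partial>T y) \<partial>\<nu>)"
    proof (rule integral_bind_complex[OF prob_\<nu> T\<nu>])
      have "(\<lambda>f. \<Sum>i\<in>K. a i * f i) \<in> borel_measurable (fun_space X borel)"
        using K by (intro borel_measurable_sum borel_measurable_times borel_measurable_const measurable_fun_space_eval) auto
      then show "(\<lambda>f. iexp (\<Sum>i\<in>K. a i * f i)) \<in> borel_measurable (fun_space X borel)"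
        by measurable
    qed simp
    also have "\<dots> = (\<integral>y. iexp (\<mu> - c * m x) * exp (- (v - c\<^sup>2 * k x x) / 2) * iexp (c * y) \<partial>\<nu>)"
    proof (intro Bochner_Integration.integral_cong refl)
      fix y
      have "iexp (\<mu> + c * (y - m x)) = iexp (\<mu> - c * m x) * iexp (c * y)"
        by (simp add: algebra_simps flip: exp_add)
      then show "(\<integral>f. iexp (\<Sum>i\<in>K. a i * f i) \<partial>T y) = iexp (\<mu> - c * m x) * exp (- (v - c\<^sup>2 * k x x) / 2) * iexp (c * y)"
        unfolding gaussian_process_linear_combination(3)[OF G K] mean cov by (simp only: mult_ac)
    qed
    also have "\<dots> = iexp (\<mu> - c * m x) * exp (- (v - c\<^sup>2 * k x x) / 2) * char \<nu> c"
      unfolding char_def by (rule integral_mult_right_zero)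
    also have "char \<nu> c = iexp (c * m x) * exp (- (c * sqrt (k x x))\<^sup>2 / 2)"
      unfolding \<nu> using x(2) by (intro char_normal_distribution) simp
    also have "(c * sqrt (k x x))\<^sup>2 = c\<^sup>2 * k x x"
      using x(2) by (simp add: power_mult_distrib)
    also have "iexp (\<mu> - c * m x) * exp (- (v - c\<^sup>2 * k x x) / 2) * (iexp (c * m x) * exp (- (c\<^sup>2 * k x x) / 2))
       = iexp \<mu> * exp (- v / 2)"
    proof -
      have mean_part: "iexp (\<mu> - c * m x) * iexp (c * m x) = iexp \<mu>"
        by (simp add: algebra_simps flip: exp_add)
      have "exp (- (v - c\<^sup>2 * k x x) / 2) * exp (- (c\<^sup>2 * k x x) / 2) = exp (- v / 2)"
        by (simp add: field_simps flip: exp_add)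
      then have variance_part: "complex_of_real (exp (- (v - c\<^sup>2 * k x x) / 2)) *
          complex_of_real (exp (- (c\<^sup>2 * k x x) / 2)) = complex_of_real (exp (- v / 2))"
        by (simp only: flip: of_real_mult)
      have regroup: "p * q * (r * s) = (p * r) * (q * s)" for p q r s :: complex
        by (simp add: mult_ac)
      show ?thesis
        by (subst regroup) (simp only: mean_part variance_part)
    qed
    also have "\<dots> = (\<integral>f. iexp (\<Sum>i\<in>K. a i * f i) \<partial>P)"
      unfolding \<mu>_def v_def by (rule gaussian_process_linear_combination(3)[OF P K, symmetric])
    finally show "(\<integral>f. iexp (\<Sum>i\<in>K. a i * f i) \<partial>P) = (\<integral>f. iexp (\<Sum>i\<in>K. a i * f i) \<partial>(\<nu> \<bind> T))" ..
  qed
  then show ?thesis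
    by (simp add: \<nu>_def)
qed

text \<open>
  The mean at \<open>x\<close> is \<open>y\<close> and the variance is \<open>0\<close>, so the evaluation at \<open>x\<close> has the point mass at \<open>y\<close>
  as its law.
\<close>

lemma gaussian_process_conditional_AE_eq:
  assumes G: "gaussian_process X Q (\<lambda>z. m z + k z x / k x x * (y - m x))
           (\<lambda>w z. k w z - k w x * k x z / k x x)"
    and x: "x \<in> space X" "k x x > 0"
  shows "AE f in Q. f x = y"
proof -
  have sets_Q: "sets Q = sets (fun_space X borel)"
    using G by (auto simp: gaussian_process_def)
  have eval: "(\<lambda>f. f x) \<in> borel_measurable Q"
    using measurable_fun_space_eval[OF x(1)] measurable_cong_sets[OF sets_Q refl] by auto
  have "distr Q borel (\<lambda>f. f x) = return borel y"
    using gaussian_process_linear_combination(2)[OF G, of "{x}" "\<lambda>_. 1"] x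
    by (simp add: normal_distribution_def)
  moreover have "AE z in return borel y. z = y"
    by (subst AE_return) auto
  ultimately have "AE z in distr Q borel (\<lambda>f. f x). z = y"
    by (simp only:)
  then show ?thesis
    using eval by (subst (asm) AE_distr_iff) auto
qed

theorem mainTheorem3:
  fixes X :: "(real ^ 'n) set"
    and m :: "real ^ 'n \<Rightarrow> real"
    and k :: "real ^ 'n \<Rightarrow> real ^ 'n \<Rightarrow> real"
    and P :: "(real ^ 'n \<Rightarrow> real) measure"
    and x :: "real ^ 'n"
    and \<I> :: "real \<Rightarrow> (real ^ 'n \<Rightarrow> real) measure"
  assumes "X = UNIV \<or> compact X"
    and "\<And>w z. w \<in> X \<Longrightarrow> z \<in> X \<Longrightarrow> k w z \<ge> 0"
    and "\<And>w z. w \<in> X \<Longrightarrow> z \<in> X \<Longrightarrow> k w z = k z w"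
    and "\<And>w z. w \<in> X \<Longrightarrow> z \<in> X \<Longrightarrow> k w w * k z z - (k w z)\<^sup>2 \<ge> 0"
    and "gaussian_process (restrict_space borel X) P m k"
    and "x \<in> X" and "k x x > 0"
    and "markov_kernel borel (fun_space (restrict_space borel X) borel) \<I>"
    and "\<And>y. gaussian_process (restrict_space borel X) (\<I> y)
           (\<lambda>z. m z + k z x / k x x * (y - m x))
           (\<lambda>w z. k w z - k w x * k x z / k x x)"
  shows "\<forall>A \<in> sets (fun_space (restrict_space borel X) borel). \<forall>B \<in> sets borel.
    (\<integral>\<^sup>+f\<in>A. emeasure (noise_free_sampling x f) B \<partial>P) =
    (\<integral>\<^sup>+y\<in>B. emeasure (\<I> y) A \<partial>(distr P borel (\<lambda>f. f x)))"
proof (intro ballI)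
  fix A B
  let ?X = "restrict_space borel X"
  let ?F = "fun_space ?X (borel :: real measure)"
  let ?\<nu> = "distr P borel (\<lambda>f. f x)"
  assume A: "A \<in> sets ?F" and B[measurable]: "B \<in> sets (borel :: real measure)"
  have space_X: "space ?X = X"
    by (simp add: space_restrict_space)
  have x: "x \<in> space ?X"
    using assms(6) space_X by simp
  have sets_P: "sets P = sets ?F"
    using assms(5) by (simp add: gaussian_process_def)
  have eval: "(\<lambda>f. f x) \<in> borel_measurable ?F"
    by (rule measurable_fun_space_eval[OF x])
  have kernel: "\<I> \<in> measurable borel (prob_algebra ?F)"
    using assms(8) by (simp add: markov_kernel_def)
  have mix: "?\<nu> \<bind> \<I> = P"
    by (rule gaussian_process_bind_conditional[OF assms(5) _ x assms(7) kernel assms(9)])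
       (use assms(3,6) space_X in auto)
  define C where "C = {f \<in> space ?F. f x \<in> B}"
  have C: "C \<in> sets ?F"
    unfolding C_def using eval by measurable
  have "(\<integral>\<^sup>+f\<in>A. emeasure (noise_free_sampling x f) B \<partial>P) = (\<integral>\<^sup>+f. indicator (A \<inter> C) f \<partial>P)"
    using sets_eq_imp_space_eq[OF sets_P]
    by (intro nn_integral_cong) (auto simp: noise_free_sampling_def C_def split: split_indicator)
  also have "\<dots> = emeasure P (A \<inter> C)"
    using A C sets_P by (intro nn_integral_indicator) auto
  also have "\<dots> = emeasure (?\<nu> \<bind> \<I>) (A \<inter> C)"
    by (simp only: mix)
  also have "\<dots> = (\<integral>\<^sup>+y. emeasure (\<I> y) (A \<inter> C) \<partial>?\<nu>)"
    using A C kernel by (intro emeasure_bind[where N = ?F]) (auto dest: measurable_prob_algebraD)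
  also have "\<dots> = (\<integral>\<^sup>+y\<in>B. emeasure (\<I> y) A \<partial>?\<nu>)"
  proof (intro nn_integral_cong)
    fix y
    have sets_I: "sets (\<I> y) = sets ?F"
      using assms(9)[of y] by (simp add: gaussian_process_def)
    have AE: "AE f in \<I> y. f x = y"
      by (rule gaussian_process_conditional_AE_eq[OF assms(9) x assms(7)])
    show "emeasure (\<I> y) (A \<inter> C) = emeasure (\<I> y) A * indicator B y"
    proof (cases "y \<in> B")
      case True
      have "emeasure (\<I> y) (A \<inter> C) = emeasure (\<I> y) A"
      proof (rule emeasure_eq_AE)
        show "AE f in \<I> y. f \<in> A \<inter> C \<longleftrightarrow> f \<in> A"
          using AE AE_space
          by eventually_elim (use True sets_eq_imp_space_eq[OF sets_I] in \<open>auto simp: C_def\<close>)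
      qed (use A C sets_I in auto)
      with True show ?thesis by simp
    next
      case False
      have "emeasure (\<I> y) (A \<inter> C) = emeasure (\<I> y) {}"
      proof (rule emeasure_eq_AE)
        show "AE f in \<I> y. f \<in> A \<inter> C \<longleftrightarrow> f \<in> {}"
          using AE by eventually_elim (use False in \<open>auto simp: C_def\<close>)
      qed (use A C sets_I in auto)
      with False show ?thesis by simp
    qed
  qed
  finally show "(\<integral>\<^sup>+f\<in>A. emeasure (noise_free_sampling x f) B \<partial>P) =
    (\<integral>\<^sup>+y\<in>B. emeasure (\<I> y) A \<partial>?\<nu>)" .
qed

end
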